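(* Let $m,n$ be integers with $m\ge 2$, $n\ge 3$, and $n$ odd. Then there exists a $1$-generated Jordan loop $Q$ with a generator $c$ such that $c^k$ is well-defined for $0\le k<mn$, but $c^{pn}c^{(m-p)n}\neq c^{mn}$ for every integer $p$ with $0<p<m$.
   Context: A loop is a quasigroup (a magma in which $ax=b$ and $ya=b$ have unique solutions for all $a,b$) with a neutral element $1$. A loop is Jordan if it is commutative and satisfies $x^2(yx)=(x^2y)x$. A loop $Q$ is $1$-generated with generator $c$ if the smallest subloop of $Q$ containing $c$ is $Q$. Powers are right-associated: $c^0=1$ and $c^k=c\,c^{k-1}$ for $k\ge 1$. For $k>0$, $c^k$ is well-defined if the value of the product $c\cdots c$ of $k$ factors $c$ does not depend on how the factors are parenthesized; $c^0=1$ is regarded as (trivially) well-defined. *)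

theory Defs
  imports "HOL-Algebra.Group"
begin

locale quasigroup =
  fixes Q (structure)
  assumes m_closed: "\<lbrakk>a \<in> carrier Q; b \<in> carrier Q\<rbrakk> \<Longrightarrow> a \<otimes> b \<in> carrier Q"
    and left_division: "\<lbrakk>a \<in> carrier Q; b \<in> carrier Q\<rbrakk> \<Longrightarrow> \<exists>!x. x \<in> carrier Q \<and> a \<otimes> x = b"
    and right_division: "\<lbrakk>a \<in> carrier Q; b \<in> carrier Q\<rbrakk> \<Longrightarrow> \<exists>!y. y \<in> carrier Q \<and> y \<otimes> a = b"

locale loop = quasigroup +
  assumes one_closed: "\<one> \<in> carrier Q"
    and l_one: "x \<in> carrier Q \<Longrightarrow> \<one> \<otimes> x = x"
    and r_one: "x \<in> carrier Q \<Longrightarrow> x \<otimes> \<one> = x"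

locale jordan_loop = loop +
  assumes m_comm: "\<lbrakk>x \<in> carrier Q; y \<in> carrier Q\<rbrakk> \<Longrightarrow> x \<otimes> y = y \<otimes> x"
    and jordan: "\<lbrakk>x \<in> carrier Q; y \<in> carrier Q\<rbrakk> \<Longrightarrow>
      (x \<otimes> x) \<otimes> (y \<otimes> x) = ((x \<otimes> x) \<otimes> y) \<otimes> x"

(* Keeping the unit of Q is no restriction: the neutral element e of a loop
   inside Q satisfies e * e = e = e * 1, so e = 1 by cancellation in Q. *)
definition subloop :: "'a set \<Rightarrow> ('a, 'b) monoid_scheme \<Rightarrow> bool" where
  "subloop H Q \<longleftrightarrow> H \<subseteq> carrier Q \<and> loop (Q\<lparr>carrier := H\<rparr>)"

definition loop_generator :: "('a, 'b) monoid_scheme \<Rightarrow> 'a \<Rightarrow> bool" where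
  "loop_generator Q c \<longleftrightarrow> c \<in> carrier Q \<and> \<Inter>{H. subloop H Q \<and> c \<in> H} = carrier Q"

(* Right-associated, c^(k+1) = c * c^k, unlike the library's (left-associated)
   power operation on monoids. *)
primrec loop_pow :: "('a, 'b) monoid_scheme \<Rightarrow> 'a \<Rightarrow> nat \<Rightarrow> 'a" where
  "loop_pow Q c 0 = \<one>\<^bsub>Q\<^esub>"
| "loop_pow Q c (Suc k) = c \<otimes>\<^bsub>Q\<^esub> loop_pow Q c k"

datatype bracketing = Factor | Product bracketing bracketing

primrec factors :: "bracketing \<Rightarrow> nat" where
  "factors Factor = 1"
| "factors (Product s t) = factors s + factors t"

primrec product_value :: "('a, 'b) monoid_scheme \<Rightarrow> 'a \<Rightarrow> bracketing \<Rightarrow> 'a" where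
  "product_value Q c Factor = c"
| "product_value Q c (Product s t) = product_value Q c s \<otimes>\<^bsub>Q\<^esub> product_value Q c t"

definition pow_well_defined :: "('a, 'b) monoid_scheme \<Rightarrow> 'a \<Rightarrow> nat \<Rightarrow> bool" where
  "pow_well_defined Q c k \<longleftrightarrow>
     k = 0 \<or> (\<forall>s t. factors s = k \<and> factors t = k \<longrightarrow> product_value Q c s = product_value Q c t)"

end

theory Submission
  imports Defs "HOL-Library.Nat_Bijection" "HOL-Combinatorics.Transposition"
begin

text \<open>
  Start from the group of integers and change the multiplication only on the subgroup
  \<open>n\<int>\<close>, where it is replaced by an isomorphic copy of itself along a permutation \<open>\<sigma>\<close> of
  \<open>n\<int>\<close> fixing \<open>0\<close>. Since \<open>n\<close> is odd, \<open>x + x \<in> n\<int>\<close> forces \<open>x \<in> n\<int>\<close>; hence for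
  \<open>x \<notin> n\<int>\<close> none of the products in the Jordan identity is affected by the change, and for
  \<open>x \<in> n\<int>\<close> the identity holds because both operations are abelian groups. Multiplication by
  \<open>c = 1 \<notin> n\<int>\<close> is still the successor map, so \<open>1\<close> generates and its right-associated \<open>k\<close>-th
  power is \<open>k\<close>. Taking for \<open>\<sigma>\<close> the transposition of \<open>mn\<close> and \<open>mn + n\<close> leaves all products
  with value below \<open>mn\<close> unchanged, but makes the product of \<open>pn\<close> and \<open>(m - p)n\<close> equal to
  \<open>mn + n\<close>.
\<close>

text \<open>The outer \<sigma> plays the role of its inverse: \<sigma> will be an
  involution.\<close>

definition twisted_add :: "int \<Rightarrow> (int \<Rightarrow> int) \<Rightarrow> int \<Rightarrow> int \<Rightarrow> int" where
  "twisted_add n \<sigma> x y = (if n dvd x \<and> n dvd y then \<sigma> (\<sigma> x + \<sigma> y) else x + y)"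

definition twisted_int_loop :: "int \<Rightarrow> (int \<Rightarrow> int) \<Rightarrow> nat monoid" where
  "twisted_int_loop n \<sigma> =
    \<lparr>carrier = UNIV,
     mult = (\<lambda>a b. int_encode (twisted_add n \<sigma> (int_decode a) (int_decode b))),
     one = int_encode 0\<rparr>"

lemma twisted_int_loop_simps [simp]:
  "carrier (twisted_int_loop n \<sigma>) = UNIV"
  "a \<otimes>\<^bsub>twisted_int_loop n \<sigma>\<^esub> b = int_encode (twisted_add n \<sigma> (int_decode a) (int_decode b))"
  "\<one>\<^bsub>twisted_int_loop n \<sigma>\<^esub> = int_encode 0"
  by (simp_all add: twisted_int_loop_def)

lemma twisted_add_commute: "twisted_add n \<sigma> x y = twisted_add n \<sigma> y x"
  by (simp add: twisted_add_def add.commute)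

locale int_twist =
  fixes n :: int and \<sigma> :: "int \<Rightarrow> int"
  assumes odd_n: "odd n"
    and involution [simp]: "\<sigma> (\<sigma> x) = x"
    and dvd_iff [simp]: "n dvd \<sigma> x \<longleftrightarrow> n dvd x"
    and fix_zero [simp]: "\<sigma> 0 = 0"
begin

lemma dvd_double_iff: "n dvd 2 * x \<longleftrightarrow> n dvd x"
proof -
  have "coprime n 2" using odd_n by simp
  then show ?thesis
    by (simp add: coprime_dvd_mult_right_iff)
qed

lemma twisted_add_zero [simp]: "twisted_add n \<sigma> 0 x = x" "twisted_add n \<sigma> x 0 = x"
  by (simp_all add: twisted_add_def)

text \<open>If \<open>n dvd a\<close>, multiplication by \<open>a\<close> is a translation of the
  transported group on the multiples of \<open>n\<close> and ordinary translation on the other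
  integers; otherwise it is ordinary translation everywhere.\<close>

lemma twisted_add_right_unique: "\<exists>!x. twisted_add n \<sigma> a x = b"
proof (cases "n dvd a")
  case True
  show ?thesis
  proof (cases "n dvd b")
    case b: True
    show ?thesis
    proof
      show "twisted_add n \<sigma> a (\<sigma> (\<sigma> b - \<sigma> a)) = b"
        using True b by (simp add: twisted_add_def)
    next
      fix x assume *: "twisted_add n \<sigma> a x = b"
      then have "n dvd x"
        using True b by (auto simp: twisted_add_def dvd_add_right_iff split: if_splits)
      with True * have "\<sigma> b = \<sigma> a + \<sigma> x"
        by (auto simp: twisted_add_def)
      then show "x = \<sigma> (\<sigma> b - \<sigma> a)" by simp
    qed
  next
    case b: False
    show ?thesis
    proof
      show "twisted_add n \<sigma> a (b - a) = b"
        using True b by (simp add: twisted_add_def dvd_diff_left_iff)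
    next
      fix x assume *: "twisted_add n \<sigma> a x = b"
      have "\<not> n dvd x"
      proof
        assume "n dvd x"
        with True have "n dvd twisted_add n \<sigma> a x" by (simp add: twisted_add_def)
        with * b show False by simp
      qed
      with * show "x = b - a" by (simp add: twisted_add_def)
    qed
  qed
next
  case False
  show ?thesis
    by (rule ex1I[of _ "b - a"]) (use False in \<open>auto simp: twisted_add_def\<close>)
qed

lemma twisted_add_jordan:
  "twisted_add n \<sigma> (twisted_add n \<sigma> x x) (twisted_add n \<sigma> y x) =
   twisted_add n \<sigma> (twisted_add n \<sigma> (twisted_add n \<sigma> x x) y) x"
proof (cases "n dvd x")
  case True
  then show ?thesis
    \<comment> \<open>If \<open>y\<close> is not a multiple of \<open>n\<close>, only the square of
      \<open>x\<close> is twisted, and both sides are the ordinary sum of that square,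
      \<open>y\<close> and \<open>x\<close>.\<close>
    by (cases "n dvd y")
      (simp_all add: twisted_add_def dvd_add_left_iff dvd_add_right_iff add.assoc)
next
  case False
  then show ?thesis
    by (simp add: twisted_add_def dvd_double_iff)
qed

lemma jordan_loop_twisted: "jordan_loop (twisted_int_loop n \<sigma>)"
proof
  fix a b :: nat
  have ex1: "\<exists>!x. int_encode (twisted_add n \<sigma> (int_decode a) (int_decode x)) = b"
  proof -
    obtain x where x: "twisted_add n \<sigma> (int_decode a) x = int_decode b"
      and uniq: "\<And>y. twisted_add n \<sigma> (int_decode a) y = int_decode b \<Longrightarrow> y = x"
      using twisted_add_right_unique by metis
    show ?thesis
    proof (rule ex1I[of _ "int_encode x"])
      show "int_encode (twisted_add n \<sigma> (int_decode a) (int_decode (int_encode x))) = b"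
        by (simp add: x)
    next
      fix z assume "int_encode (twisted_add n \<sigma> (int_decode a) (int_decode z)) = b"
      then have "int_decode z = x"
        by (intro uniq) auto
      then show "z = int_encode x" by auto
    qed
  qed
  then show "\<exists>!x. x \<in> carrier (twisted_int_loop n \<sigma>) \<and> a \<otimes>\<^bsub>twisted_int_loop n \<sigma>\<^esub> x = b"
    by simp
  from ex1 show "\<exists>!y. y \<in> carrier (twisted_int_loop n \<sigma>) \<and> y \<otimes>\<^bsub>twisted_int_loop n \<sigma>\<^esub> a = b"
    by (subst (asm) twisted_add_commute) simp
next
  fix a b :: nat
  show "a \<otimes>\<^bsub>twisted_int_loop n \<sigma>\<^esub> b = b \<otimes>\<^bsub>twisted_int_loop n \<sigma>\<^esub> a"
    by (simp only: twisted_int_loop_simps twisted_add_commute[of n \<sigma> "int_decode a"])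
qed (simp_all add: twisted_add_jordan)

lemma twisted_add_one:
  assumes "\<not> n dvd 1"
  shows "twisted_add n \<sigma> 1 x = x + 1"
  using assms by (simp add: twisted_add_def)

lemma loop_pow_twisted:
  assumes "\<not> n dvd 1"
  shows "loop_pow (twisted_int_loop n \<sigma>) (int_encode 1) k = int_encode (int k)"
  by (induction k) (simp_all add: twisted_add_one[OF assms] add.commute)

text \<open>Starting from 1, closure under products climbs to the larger integers, and closure under
  division by 1 descends to the smaller ones.\<close>

lemma loop_generator_twisted:
  assumes "\<not> n dvd 1"
  shows "loop_generator (twisted_int_loop n \<sigma>) (int_encode 1)"
proof -
  have "int_encode z \<in> H"
    if H: "subloop H (twisted_int_loop n \<sigma>)" and one: "int_encode 1 \<in> H" for H z
  proof -
    interpret H: loop "twisted_int_loop n \<sigma>\<lparr>carrier := H\<rparr>"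
      using H by (simp add: subloop_def)
    show ?thesis
    proof (induction z rule: int_induct[where k = 1])
      case base
      show ?case by (fact one)
    next
      case (step1 i)
      from H.m_closed[of "int_encode 1" "int_encode i"] step1 one show ?case
        by (simp add: twisted_add_one[OF assms])
    next
      case (step2 i)
      from H.left_division[of "int_encode 1" "int_encode i"] step2 one
      obtain x where x: "x \<in> H" "int_encode (int_decode x + 1) = int_encode i"
        by (auto simp: twisted_add_one[OF assms])
      then have "int_decode x = i - 1"
        by (simp add: int_encode_eq)
      with x(1) show ?case
        by (metis int_decode_inverse)
    qed
  qed
  from this[of _ "int_decode _"]
  have "x \<in> H" if "subloop H (twisted_int_loop n \<sigma>)" "int_encode 1 \<in> H" for H x
    using that by simp
  then show ?thesis
    unfolding loop_generator_def twisted_int_loop_simps by blast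
qed

text \<open>All partial products are sums in the range from 0 to below \<open>N\<close>, where
  \<sigma> is the identity, so the twist is never seen.\<close>

lemma product_value_twisted:
  assumes fixed: "\<And>x. 0 \<le> x \<Longrightarrow> x < N \<Longrightarrow> \<sigma> x = x"
    and "int (factors t) < N"
  shows "product_value (twisted_int_loop n \<sigma>) (int_encode 1) t = int_encode (int (factors t))"
  using assms(2)
proof (induction t)
  case (Product s t)
  then show ?case by (simp add: twisted_add_def fixed)
qed simp

end

theorem theorem5p5:
  fixes m n :: nat
  assumes "m \<ge> 2" and "n \<ge> 3" and "odd n"
  shows "\<exists>(Q :: nat monoid) c.
    jordan_loop Q \<and> loop_generator Q c \<and>
    (\<forall>k. 0 \<le> k \<and> k < m * n \<longrightarrow> pow_well_defined Q c k) \<and>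
    (\<forall>p. 0 < p \<and> p < m \<longrightarrow>
      loop_pow Q c (p * n) \<otimes>\<^bsub>Q\<^esub> loop_pow Q c ((m - p) * n) \<noteq> loop_pow Q c (m * n))"
proof -
  \<comment> \<open>Both swapped points are positive multiples of \<open>n\<close>, so 0 is fixed
    and divisibility by \<open>n\<close> is preserved.\<close>
  define \<sigma> where "\<sigma> = transpose (int (m * n)) (int (m * n + n))"
  have fixed: "\<sigma> x = x" if "x < int (m * n)" for x
    using that by (simp add: \<sigma>_def transpose_def)
  interpret int_twist "int n" \<sigma>
    using assms fixed[of 0] by unfold_locales (auto simp: \<sigma>_def transpose_def)
  have one: "\<not> int n dvd 1"
    using assms by simp
  let ?Q = "twisted_int_loop (int n) \<sigma>" and ?c = "int_encode 1"
  have "pow_well_defined ?Q ?c k" if "k < m * n" for k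
  proof -
    have "product_value ?Q ?c t = int_encode (int k)" if "factors t = k" for t
      using product_value_twisted[OF fixed, of "int (m * n)" t] that \<open>k < m * n\<close>
      by (simp del: of_nat_mult)
    then show ?thesis by (simp add: pow_well_defined_def)
  qed
  moreover have "loop_pow ?Q ?c (p * n) \<otimes>\<^bsub>?Q\<^esub> loop_pow ?Q ?c ((m - p) * n)
      \<noteq> loop_pow ?Q ?c (m * n)" if "0 < p" "p < m" for p
  proof -
    \<comment> \<open>Since \<open>0 < p < m\<close>, both factors lie strictly below
      \<open>m * n\<close> and are fixed by \<sigma>; only their sum \<open>m * n\<close> is
      moved.\<close>
    have "p * n < m * n" "(m - p) * n < m * n"
      using that assms by simp_all
    then have "\<sigma> (int (p * n)) = int (p * n)" "\<sigma> (int ((m - p) * n)) = int ((m - p) * n)"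
      by (auto intro!: fixed simp only: of_nat_less_iff)
    moreover have "int (p * n) + int ((m - p) * n) = int (m * n)"
      using that by (simp flip: of_nat_add of_nat_mult distrib_right)
    moreover have "int n dvd int (p * n)" "int n dvd int ((m - p) * n)"
      by (simp_all only: of_nat_dvd_iff dvd_triv_right)
    ultimately have "twisted_add (int n) \<sigma> (int (p * n)) (int ((m - p) * n)) = int (m * n + n)"
      by (simp only: twisted_add_def simp_thms if_True) (simp add: \<sigma>_def)
    then show ?thesis
      using assms by (simp add: loop_pow_twisted[OF one] int_encode_eq del: of_nat_mult)
  qed
  ultimately show ?thesis
    using jordan_loop_twisted loop_generator_twisted[OF one] by blast
qed

end
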